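(* Let $r$ and $n$ be nonnegative integers and let $G$ be a graph on $n$ vertices with maximum degree $\Delta(G) \le r$. Let $\vec n = (n_1, \dots, n_d)$ be a vector of positive integers with $\sum_{i=1}^d n_i = n$ such that $n_i \le \lfloor n/(r+1) \rfloor$ for all $i \in [d]$. Then there exists an $\vec n$-coloring of $G$.
   Context: Graphs are finite and simple, and $[d] = \{1,\dots,d\}$. Given a vector $\vec n = (n_1,\dots,n_d)$ of positive integers summing to $n$ (a color vector), an $\vec n$-coloring (or prescribed coloring) of a graph $G$ on $n$ vertices is a proper coloring of the vertices of $G$ with colors $1,\dots,d$ such that for each $i \in [d]$ exactly $n_i$ vertices receive color $i$. *)

theory Defs
  imports "Graph_Theory.Digraph" "HOL-Library.FuncSet"
begin

text \<open>
  A finite simple graph is a \<^locale>\<open>graph\<close>, i.e. a finite, loopless, symmetric digraph without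
  parallel arcs.  Each undirected edge is a pair of opposite arcs, so the degree of a vertex is its
  \<^const>\<open>out_degree\<close>.  Inserting \<open>0\<close> gives the null graph maximum degree \<open>0\<close>.
\<close>

definition max_degree :: "('a, 'b) pre_digraph \<Rightarrow> nat" where
  "max_degree G = Max (insert 0 (out_degree G ` verts G))"

text \<open>
  A vector \<open>(c 1, \<dots>, c d)\<close> is a length \<open>d\<close> together with a function \<open>c\<close>, of which only the values
  on \<open>{1..d}\<close> matter.
\<close>

definition color_vector :: "nat \<Rightarrow> nat \<Rightarrow> (nat \<Rightarrow> nat) \<Rightarrow> bool" where
  "color_vector n d c \<longleftrightarrow> (\<forall>i\<in>{1..d}. c i > 0) \<and> (\<Sum>i=1..d. c i) = n"

definition proper_coloring :: "('a, 'b) pre_digraph \<Rightarrow> nat \<Rightarrow> ('a \<Rightarrow> nat) \<Rightarrow> bool" where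
  "proper_coloring G d f \<longleftrightarrow>
     f \<in> verts G \<rightarrow> {1..d} \<and> (\<forall>u v. u \<rightarrow>\<^bsub>G\<^esub> v \<longrightarrow> f u \<noteq> f v)"

definition prescribed_coloring ::
    "('a, 'b) pre_digraph \<Rightarrow> nat \<Rightarrow> (nat \<Rightarrow> nat) \<Rightarrow> ('a \<Rightarrow> nat) \<Rightarrow> bool" where
  "prescribed_coloring G d c f \<longleftrightarrow>
     proper_coloring G d f \<and> (\<forall>i\<in>{1..d}. card {v \<in> verts G. f v = i} = c i)"

end

(*
  Kierstead and Kostochka's short proof of the Hajnal-Szemeredi theorem survives unequal class
  sizes. Put s = n div (r + 1). Adding the edges one vertex at a time leads to proper colorings in
  which one class v has a vertex too few and one class p a vertex too many. A class is accessible
  if vertices can be shifted along a chain of classes from it to v; if p is accessible, shifting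
  finishes. Otherwise every vertex of the set B of inaccessibly colored vertices has a neighbor in
  each of the m accessible classes, so B induces maximum degree at most r - m, while
  card B > s * (r + 1 - m) because all classes have size at most s. Hence for any y in B the graph
  on B - y satisfies the hypotheses for the remaining colors and can be recolored by induction. A
  discharging argument finds a solo edge between B and a terminal accessible class along which
  recoloring either finishes or makes more classes accessible.
*)

theory Submission
  imports Defs
begin

section \<open>Cut vertices and terminal vertices of a digraph\<close>

text \<open>Let \<open>T U\<close> be the part of \<open>A\<close> that is cut off from
  \<open>v\<close> when \<open>U\<close> is deleted. Since \<open>T v\<close> is
  \<open>A - {v}\<close>, some \<open>T U\<close> is nonempty; take one of least size. For
  \<open>W\<close> in \<open>T U\<close>, the set \<open>T W\<close> is a proper subset of
  \<open>T U\<close>, hence empty by minimality.\<close>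

lemma exists_terminal_set:
  fixes D :: "('c \<times> 'c) set" and v :: 'c
  defines "avoid U \<equiv> {i. (i, v) \<in> (D \<inter> {(i, j). i \<noteq> U \<and> j \<noteq> U})\<^sup>*}"
  assumes fin: "finite A" and acc: "\<And>i. i \<in> A \<Longrightarrow> (i, v) \<in> D\<^sup>*"
    and v: "v \<in> A" and ne: "A \<noteq> {v}"
  obtains U T where "U \<in> A" "T \<subseteq> A - {U, v}" "T \<noteq> {}"
    "\<And>i j. i \<in> T \<Longrightarrow> j \<in> A - {U} - T \<Longrightarrow> (i, j) \<notin> D"
    "\<And>W i. W \<in> T \<Longrightarrow> i \<in> A - {W} \<Longrightarrow> (i, v) \<in> (D \<inter> {(i, j). i \<noteq> W \<and> j \<noteq> W})\<^sup>*"
proof -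
  define T where "T U = A - {U} - avoid U" for U
  have v_avoid: "v \<in> avoid U" for U by (simp add: avoid_def)
  have avoid_step: "i \<in> avoid U" if "(i, j) \<in> D" "i \<noteq> U" "j \<noteq> U" "j \<in> avoid U" for i j U
    using that by (auto simp: avoid_def intro: converse_rtrancl_into_rtrancl)
  have self: "U \<notin> avoid U" if "U \<noteq> v" for U
    using that by (auto simp: avoid_def elim: converse_rtranclE)
  \<comment> \<open>A path to \<open>v\<close> that misses \<open>U\<close> stays inside
    \<open>avoid U\<close>, so it misses \<open>W\<close> as well.\<close>
  have mono: "i \<in> avoid W" if "i \<in> avoid U" "W \<notin> avoid U" for i U W
  proof -
    have "(i, v) \<in> (D \<inter> {(i, j). i \<noteq> U \<and> j \<noteq> U})\<^sup>*" using that by (simp add: avoid_def)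
    then have "i \<in> avoid U \<and> i \<in> avoid W"
    proof (induction rule: converse_rtrancl_induct)
      case base then show ?case by (simp add: v_avoid)
    next
      case (step i j)
      then have "i \<in> avoid U" using avoid_step by blast
      moreover have "i \<noteq> W" "j \<noteq> W" using \<open>i \<in> avoid U\<close> step.IH that(2) by auto
      ultimately show ?case using step avoid_step[of i j W] by simp
    qed
    then show ?thesis by simp
  qed
  have "avoid v = {v}"
    by (auto simp: avoid_def elim: rtranclE)
  then have "T v \<noteq> {}" using v ne by (auto simp: T_def)
  then have "\<exists>U. U \<in> A \<and> T U \<noteq> {}" using v by blast
  then obtain U where U: "U \<in> A" "T U \<noteq> {}"
    and least: "\<And>W. W \<in> A \<Longrightarrow> T W \<noteq> {} \<Longrightarrow> card (T U) \<le> card (T W)"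
    using ex_has_least_nat[of "\<lambda>U. U \<in> A \<and> T U \<noteq> {}" _ "\<lambda>U. card (T U)"] by blast
  have terminal: "T W = {}" if W: "W \<in> T U" for W
  proof (rule ccontr)
    assume neW: "T W \<noteq> {}"
    have Wn: "W \<notin> avoid U" "W \<in> A" "W \<noteq> U" using W by (auto simp: T_def)
    have "U \<in> avoid W"
    proof (cases "U = v")
      case True then show ?thesis by (simp add: v_avoid)
    next
      case False
      \<comment> \<open>After its last visit to \<open>U\<close>, a path to \<open>v\<close> runs
        inside \<open>avoid U\<close>, hence inside \<open>avoid W\<close>, so \<open>U\<close>
        itself reaches \<open>v\<close> without meeting \<open>W\<close>. For \<open>k = U\<close>
        the first alternative is excluded by \<open>self\<close>.\<close>
      have "k \<in> avoid U \<or> U \<in> avoid W" if "(k, v) \<in> D\<^sup>*" for k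
        using that
      proof (induction rule: converse_rtrancl_induct)
        case base then show ?case by (simp add: v_avoid)
      next
        case (step k j)
        show ?case
        proof (cases "U \<in> avoid W")
          case False
          with step.IH have j: "j \<in> avoid U" by simp
          then have "j \<noteq> U" using self[OF \<open>U \<noteq> v\<close>] by blast
          show ?thesis
          proof (cases "k = U")
            case True
            have "j \<in> avoid W" "j \<noteq> W" using mono j Wn by blast+
            then show ?thesis using avoid_step[of k j W] step.hyps(1) True Wn by simp
          next
            case False
            then show ?thesis using avoid_step[OF step.hyps(1) False \<open>j \<noteq> U\<close> j] by simp
          qed
        qed simp
      qed
      then show ?thesis using self[OF False] acc U by blast
    qed
    then have "T W \<subseteq> T U" using mono[OF _ Wn(1)] by (auto simp: T_def)
    moreover have "W \<notin> T W" by (simp add: T_def)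
    ultimately have "T W \<subset> T U" using W by blast
    moreover have "finite (T U)" using fin by (simp add: T_def)
    ultimately show False using least[OF Wn(2) neW] psubset_card_mono by (metis leD)
  qed
  show ?thesis
  proof (rule that[of U "T U"])
    show "(i, j) \<notin> D" if "i \<in> T U" "j \<in> A - {U} - T U" for i j
      using that avoid_step[of i j U] by (auto simp: T_def)
    show "(i, v) \<in> (D \<inter> {(i, j). i \<noteq> W \<and> j \<noteq> W})\<^sup>*" if "W \<in> T U" "i \<in> A - {W}" for W i
      using terminal[OF that(1)] that(2) by (auto simp: T_def avoid_def)
  qed (use U v_avoid in \<open>auto simp: T_def\<close>)
qed

section \<open>Colorings of vertex sets and shifts along chains of classes\<close>

definition proper_on :: "('a \<Rightarrow> 'a \<Rightarrow> bool) \<Rightarrow> 'a set \<Rightarrow> 'c set \<Rightarrow> ('a \<Rightarrow> 'c) \<Rightarrow> bool" where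
  "proper_on E X I f \<longleftrightarrow> (\<forall>x\<in>X. f x \<in> I) \<and> (\<forall>x\<in>X. \<forall>y\<in>X. E x y \<longrightarrow> f x \<noteq> f y)"

definition nbrs :: "('a \<Rightarrow> 'a \<Rightarrow> bool) \<Rightarrow> 'a set \<Rightarrow> 'a \<Rightarrow> 'a set" where
  "nbrs E Y x = {y \<in> Y. E x y}"

definition color_class :: "'a set \<Rightarrow> ('a \<Rightarrow> 'c) \<Rightarrow> 'c \<Rightarrow> 'a set" where
  "color_class X f i = {x \<in> X. f x = i}"

definition movable :: "('a \<Rightarrow> 'a \<Rightarrow> bool) \<Rightarrow> 'a set \<Rightarrow> ('a \<Rightarrow> 'c) \<Rightarrow> 'a \<Rightarrow> 'c \<Rightarrow> bool" where
  "movable E X f x j \<longleftrightarrow> f x \<noteq> j \<and> (\<forall>y\<in>X. E x y \<longrightarrow> f y \<noteq> j)"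

text \<open>The auxiliary digraph on the colors. Targets are not restricted to a color set
  \<open>I\<close>, but if \<open>f\<close> maps \<open>X\<close> into \<open>I\<close>, no arc
  leaves a color outside \<open>I\<close>, so such a color lies on no path to a color in
  \<open>I\<close>.\<close>

definition move_rel :: "('a \<Rightarrow> 'a \<Rightarrow> bool) \<Rightarrow> 'a set \<Rightarrow> ('a \<Rightarrow> 'c) \<Rightarrow> ('c \<times> 'c) set" where
  "move_rel E X f = {(f x, j) | x j. x \<in> X \<and> movable E X f x j}"

text \<open>The growing set \<open>S\<close> in the induction replaces the choice of a path without repetitions: the
  recolorings constructed so far do not touch the classes outside \<open>S\<close>.\<close>

lemma shift_along_path:
  fixes f :: "'a \<Rightarrow> 'c"
  assumes fin: "finite X" and sym: "\<And>x y. E x y \<Longrightarrow> E y x" and irrefl: "\<And>x. \<not> E x x"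
    and f: "proper_on E X I f" and v: "v \<in> I"
    and R: "R \<subseteq> move_rel E X f" and path: "(i, v) \<in> R\<^sup>*"
  obtains g where "proper_on E X I g"
    "\<And>x. x \<in> X \<Longrightarrow> g x \<noteq> f x \<Longrightarrow> (f x, v) \<in> R\<^sup>* \<and> (g x, v) \<in> R\<^sup>*"
    "\<And>x. x \<in> X \<Longrightarrow> g x = i \<Longrightarrow> f x = i"
    "\<And>k. card (color_class X g k) + of_bool (k = i) = card (color_class X f k) + of_bool (k = v)"
proof -
  \<comment> \<open>The vacancy has moved from \<open>v\<close> to \<open>k\<close>, with changes
    only among the classes in \<open>S\<close>. Class \<open>k\<close> has at most lost vertices, so
    a vertex movable to \<open>k\<close> under \<open>f\<close> can still enter it under
    \<open>g\<close>.\<close>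
  define Q where "Q S k g \<longleftrightarrow> proper_on E X I g \<and> (\<forall>x\<in>X. g x \<noteq> f x \<longrightarrow> f x \<in> S \<and> g x \<in> S) \<and>
      (\<forall>x\<in>X. g x = k \<longrightarrow> f x = k) \<and>
      (\<forall>l. card (color_class X g l) + of_bool (l = k)
          = card (color_class X f l) + of_bool (l = v))" for S k g
  have "\<exists>S. i \<in> S \<and> S \<subseteq> {k. (k, v) \<in> R\<^sup>*} \<and> (\<forall>k\<in>S. \<exists>g. Q S k g)"
    using path
  proof (induction rule: converse_rtrancl_induct)
    case base
    have "Q {v} v f" using f by (simp add: Q_def)
    then show ?case by (intro exI[of _ "{v}"]) auto
  next
    case (step i j)
    then obtain S where S: "j \<in> S" "S \<subseteq> {k. (k, v) \<in> R\<^sup>*}" "\<And>k. k \<in> S \<Longrightarrow> \<exists>g. Q S k g" by blast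
    show ?case
    proof (cases "i \<in> S")
      case True
      then show ?thesis using S by blast
    next
      case False
      obtain g where g: "Q S j g" using S by blast
      obtain x where x: "x \<in> X" "f x = i" "movable E X f x j"
        using step.hyps(1) R by (auto simp: move_rel_def)
      have jI: "j \<in> I"
      proof (cases "j = v")
        case False
        then obtain k where "(j, k) \<in> R" using step.hyps(2) by (meson converse_rtranclE)
        then show ?thesis using R f by (auto simp: move_rel_def proper_on_def)
      qed (use v in simp)
      have gx: "g x = i" using g x False by (auto simp: Q_def)
      have ij: "i \<noteq> j" using S False by blast
      have same: "f y = i" if "y \<in> X" "g y = i" for y
        using g that False by (auto simp: Q_def)
      define h where "h = g(x := j)"
      have "Q (insert i S) i h"
        unfolding Q_def
      proof (intro conjI ballI impI allI)
        have "g y \<noteq> j" if "y \<in> X" "E x y" for y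
          using that x g by (auto simp: Q_def movable_def)
        then show "proper_on E X I h"
          using g jI sym irrefl by (fastforce simp: Q_def proper_on_def h_def)
        show "f y \<in> insert i S" if "y \<in> X" "h y \<noteq> f y" for y
          using that g x by (auto simp: Q_def h_def split: if_splits)
        show "h y \<in> insert i S" if "y \<in> X" "h y \<noteq> f y" for y
          using that g x S by (auto simp: Q_def h_def split: if_splits)
        show "f y = i" if "y \<in> X" "h y = i" for y
          using that same ij by (auto simp: h_def split: if_splits)
        show "card (color_class X h l) + of_bool (l = i)
            = card (color_class X f l) + of_bool (l = v)" for l
        proof -
          have sz: "card (color_class X g l) + of_bool (l = j)
            = card (color_class X f l) + of_bool (l = v)" using g by (simp add: Q_def)
          have finc: "finite (color_class X g l)" using fin by (simp add: color_class_def)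
          consider "l = i" | "l = j" | "l \<noteq> i" "l \<noteq> j" by blast
          then show ?thesis
          proof cases
            case 1
            have "color_class X h l = color_class X g l - {x}" "x \<in> color_class X g l"
              using 1 gx ij x by (auto simp: color_class_def h_def)
            then show ?thesis using sz 1 ij finc card_Suc_Diff1 by fastforce
          next
            case 2
            have "color_class X h l = insert x (color_class X g l)" "x \<notin> color_class X g l"
              using 2 gx ij x by (auto simp: color_class_def h_def)
            then show ?thesis using sz 2 ij finc by simp
          next
            case 3
            have "color_class X h l = color_class X g l"
              using 3 gx by (auto simp: color_class_def h_def)
            then show ?thesis using sz 3 by simp
          qed
        qed
      qed
      moreover have "Q (insert i S) k g" if "Q S k g" for k g
        using that by (auto simp: Q_def)
      moreover have "(i, v) \<in> R\<^sup>*" using step.hyps by (rule converse_rtrancl_into_rtrancl)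
      ultimately show ?thesis using S(2,3)
        by (intro exI[of _ "insert i S"]) blast
    qed
  qed
  then obtain S g where "S \<subseteq> {k. (k, v) \<in> R\<^sup>*}" "Q S i g" by blast
  then show ?thesis using that[of g] by (fastforce simp: Q_def)
qed

lemma card_exchange: "finite S \<Longrightarrow> z \<in> S \<Longrightarrow> y \<notin> S \<Longrightarrow> card (insert y (S - {z})) = card S"
  by (metis Diff_iff card_Suc_Diff1 card_insert_disjoint finite_Diff)

lemma double_counting_le:
  assumes "finite P" "finite Q"
    and "\<And>y. y \<in> Q \<Longrightarrow> k \<le> card {x \<in> P. E x y}"
    and "\<And>x. x \<in> P \<Longrightarrow> card {y \<in> Q. E x y} \<le> l"
  shows "k * card Q \<le> l * card (P :: 'a set)"
proof -
  have "k * card Q \<le> (\<Sum>y\<in>Q. card {x \<in> P. E x y})"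
    using sum_mono[of Q "\<lambda>_. k"] assms by (simp add: mult.commute)
  also have "\<dots> = (\<Sum>x\<in>P. card {y \<in> Q. E x y})"
    using assms sum_multicount_gen[of Q P "\<lambda>y x. E x y"] by simp
  also have "\<dots> \<le> l * card P"
    using sum_mono[of P _ "\<lambda>_. l"] assms by (simp add: mult.commute)
  finally show ?thesis .
qed

section \<open>Accessible classes and near-colorings\<close>

definition accessible :: "('a \<Rightarrow> 'a \<Rightarrow> bool) \<Rightarrow> 'a set \<Rightarrow> ('a \<Rightarrow> 'c) \<Rightarrow> 'c \<Rightarrow> 'c set" where
  "accessible E X f v = {i. (i, v) \<in> (move_rel E X f)\<^sup>*}"

definition sized_coloring ::
    "('a \<Rightarrow> 'a \<Rightarrow> bool) \<Rightarrow> 'a set \<Rightarrow> 'c set \<Rightarrow> ('c \<Rightarrow> nat) \<Rightarrow> ('a \<Rightarrow> 'c) \<Rightarrow> bool" where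
  "sized_coloring E X I c f \<longleftrightarrow> proper_on E X I f \<and> (\<forall>i\<in>I. card (color_class X f i) = c i)"

text \<open>Every class has its prescribed size, except that class \<open>v\<close> is one vertex short and class \<open>p\<close>
  has one vertex too many; for \<open>v = p\<close> the two deviations cancel.\<close>

locale near_coloring =
  fixes E :: "'a \<Rightarrow> 'a \<Rightarrow> bool" and X :: "'a set" and I :: "'c set" and c :: "'c \<Rightarrow> nat"
    and r s :: nat and f :: "'a \<Rightarrow> 'c" and v p :: 'c
  assumes fin_X: "finite X" and fin_I: "finite I"
    and sym: "\<And>x y. E x y \<Longrightarrow> E y x" and irrefl: "\<And>x. \<not> E x x"
    and degree: "\<And>x. x \<in> X \<Longrightarrow> card (nbrs E X x) \<le> r"
    and c_le: "\<And>i. i \<in> I \<Longrightarrow> c i \<le> s" and large: "s * (r + 1) \<le> card X"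
    and sum_c: "sum c I = card X"
    and proper: "proper_on E X I f" and v_in: "v \<in> I" and p_in: "p \<in> I"
    and sizes: "\<And>i. i \<in> I \<Longrightarrow>
      card (color_class X f i) + of_bool (i = v) = c i + of_bool (i = p)"
begin

abbreviation Acc :: "'c set" where "Acc \<equiv> accessible E X f v"

definition B :: "'a set" where "B = {x \<in> X. f x \<notin> Acc}"

definition N :: "'a \<Rightarrow> 'c \<Rightarrow> 'a set" where "N y i = {x \<in> X. f x = i \<and> E y x}"

lemma f_in: "x \<in> X \<Longrightarrow> f x \<in> I"
  using proper by (simp add: proper_on_def)

lemma f_proper: "x \<in> X \<Longrightarrow> y \<in> X \<Longrightarrow> E x y \<Longrightarrow> f x \<noteq> f y"
  using proper by (simp add: proper_on_def)

lemma v_Acc: "v \<in> Acc"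
  by (simp add: accessible_def)

lemma Acc_subset: "Acc \<subseteq> I"
proof
  fix i assume "i \<in> Acc"
  then have "(i, v) \<in> (move_rel E X f)\<^sup>*" by (simp add: accessible_def)
  then show "i \<in> I"
    by (cases rule: converse_rtranclE) (use v_in f_in in \<open>auto simp: move_rel_def\<close>)
qed

lemma Acc_step: "x \<in> X \<Longrightarrow> movable E X f x j \<Longrightarrow> j \<in> Acc \<Longrightarrow> f x \<in> Acc"
  by (auto simp: accessible_def move_rel_def intro: converse_rtrancl_into_rtrancl)

lemma fin_Acc: "finite Acc"
  using Acc_subset fin_I finite_subset by blast

lemma fin_B: "finite B"
  using fin_X by (simp add: B_def)

lemma fin_N: "finite (N y i)"
  using fin_X by (simp add: N_def)

text \<open>Shifting along a path from \<open>p\<close> to \<open>v\<close> takes the surplus vertex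
  out of class \<open>p\<close> and fills the gap in class \<open>v\<close>. For
  \<open>p = v\<close> the sizes are right from the start.\<close>

lemma coloring_if_accessible:
  assumes "p \<in> Acc"
  shows "\<exists>g. sized_coloring E X I c g"
proof -
  have path: "(p, v) \<in> (move_rel E X f)\<^sup>*" using assms by (simp add: accessible_def)
  obtain g where g: "proper_on E X I g"
    "\<And>k. card (color_class X g k) + of_bool (k = p) = card (color_class X f k) + of_bool (k = v)"
    using shift_along_path[OF fin_X sym irrefl proper v_in subset_refl path] by metis
  have "card (color_class X g i) = c i" if "i \<in> I" for i
    using g(2)[of i] sizes[OF that] by (simp split: if_splits)
  then show ?thesis using g(1) by (auto simp: sized_coloring_def)
qed

lemma degree_split:
  assumes "y \<in> X"
  shows "card (nbrs E B y) + (\<Sum>i\<in>Acc. card (N y i)) \<le> r"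
proof -
  have "(\<Sum>i\<in>Acc. card (N y i)) = card (\<Union>i\<in>Acc. N y i)"
    by (rule card_UN_disjoint[symmetric]) (use fin_Acc fin_N in \<open>auto simp: N_def\<close>)
  moreover have "nbrs E X y = nbrs E B y \<union> (\<Union>i\<in>Acc. N y i)"
    by (auto simp: nbrs_def B_def N_def)
  moreover have "card (nbrs E B y \<union> (\<Union>i\<in>Acc. N y i)) = card (nbrs E B y) + card (\<Union>i\<in>Acc. N y i)"
    by (rule card_Un_disjoint) (use fin_Acc fin_N fin_X in \<open>auto simp: N_def B_def nbrs_def\<close>)
  ultimately show ?thesis using degree[OF assms] by simp
qed

end

section \<open>Inaccessible surplus class: degrees and sizes\<close>

locale stuck_coloring = near_coloring +
  assumes p_not_Acc: "p \<notin> Acc"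
begin

lemma p_neq_v: "p \<noteq> v"
  using p_not_Acc v_Acc by blast

text \<open>Otherwise \<open>y\<close> could move to class \<open>i\<close>, and its own class would
  be accessible.\<close>

lemma N_nonempty: "y \<in> B \<Longrightarrow> i \<in> Acc \<Longrightarrow> N y i \<noteq> {}"
  using Acc_step[of y i] by (auto simp: B_def N_def movable_def)

lemma card_N_pos: "y \<in> B \<Longrightarrow> i \<in> Acc \<Longrightarrow> 1 \<le> card (N y i)"
  using N_nonempty fin_N by (simp add: Suc_le_eq card_gt_0_iff)

lemma degree_B: "y \<in> B \<Longrightarrow> card (nbrs E B y) + card Acc \<le> r"
  using degree_split[of y] sum_mono[of Acc "\<lambda>_. 1" "\<lambda>i. card (N y i)"] card_N_pos[of y]
  by (simp add: B_def)

lemma card_color_class_le: "i \<in> Acc \<Longrightarrow> card (color_class X f i) \<le> s"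
  using sizes[of i] c_le[of i] Acc_subset p_not_Acc by (cases "i = p") auto

text \<open>The gap lies in an accessible class and the surplus in an inaccessible one; the surplus
  is the \<open>+ 1\<close>.\<close>

lemma card_B_eq: "card B = (\<Sum>i\<in>I - Acc. c i) + 1"
proof -
  have "card B = card (\<Union>i\<in>I - Acc. color_class X f i)"
    by (rule arg_cong[of _ _ card]) (use f_in in \<open>auto simp: B_def color_class_def\<close>)
  also have "\<dots> = (\<Sum>i\<in>I - Acc. card (color_class X f i))"
    by (rule card_UN_disjoint) (use fin_I fin_X in \<open>auto simp: color_class_def\<close>)
  also have "\<dots> = (\<Sum>i\<in>I - Acc. c i + of_bool (i = p))"
  proof (rule sum.cong)
    fix i assume i: "i \<in> I - Acc"
    then have "i \<noteq> v" using v_Acc by blast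
    then show "card (color_class X f i) = c i + of_bool (i = p)" using sizes[of i] i by simp
  qed simp
  also have "\<dots> = (\<Sum>i\<in>I - Acc. c i) + 1"
    using p_in p_not_Acc fin_I
    by (simp add: sum.distrib of_bool_def sum.delta)
  finally show ?thesis .
qed

text \<open>Any vertex of the nonempty set \<open>B\<close> has a neighbor in every accessible
  class. The bound makes the subtraction in \<open>r + 1 - card Acc\<close> exact and its value
  positive.\<close>

lemma card_Acc_le: "card Acc \<le> r"
proof -
  have "B \<noteq> {}" using card_B_eq by auto
  then show ?thesis using degree_B by fastforce
qed

text \<open>The accessible classes account for at most \<open>s * card Acc\<close> of the prescribed
  total, which is at least \<open>s * (r + 1)\<close>. Only the upper bound \<open>s\<close> on the
  sizes enters, so they may be unequal.\<close>

lemma card_B_ge: "s * (r + 1 - card Acc) + 1 \<le> card B"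
proof -
  have "sum c I = (\<Sum>i\<in>I - Acc. c i) + sum c Acc"
    using sum.subset_diff[OF Acc_subset fin_I] by simp
  moreover have "sum c Acc \<le> s * card Acc"
    using sum_mono[of Acc c "\<lambda>_. s"] c_le Acc_subset by (auto simp: mult.commute)
  moreover have "s * (r + 1) = s * (r + 1 - card Acc) + s * card Acc"
    using card_Acc_le by (simp flip: distrib_left)
  ultimately show ?thesis using card_B_eq large sum_c by linarith
qed

text \<open>Class \<open>v\<close> has fewer than \<open>s\<close> vertices, each of degree at most
  \<open>r\<close>, so it cannot supply a neighbor to each of the more than \<open>r * s\<close>
  vertices of \<open>B\<close>.\<close>

lemma Acc_not_singleton: "Acc \<noteq> {v}"
proof
  assume A: "Acc = {v}"
  let ?V = "color_class X f v"
  have "1 * card B \<le> r * card ?V"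
  proof (rule double_counting_le)
    show "1 \<le> card {x \<in> ?V. E x y}" if "y \<in> B" for y
    proof -
      have "{x \<in> ?V. E x y} = N y v" by (auto simp: color_class_def N_def sym)
      then show ?thesis using card_N_pos[OF that v_Acc] by simp
    qed
    show "card {y \<in> B. E x y} \<le> r" if "x \<in> ?V" for x
    proof -
      have "x \<in> X" using that by (simp add: color_class_def)
      have "card {y \<in> B. E x y} \<le> card (nbrs E X x)"
        by (rule card_mono) (use fin_X in \<open>auto simp: B_def nbrs_def\<close>)
      then show ?thesis using degree[OF \<open>x \<in> X\<close>] by simp
    qed
  qed (use fin_X fin_B in \<open>auto simp: color_class_def\<close>)
  moreover have "card ?V + 1 \<le> s"
    using sizes[OF v_in] p_neq_v c_le[OF v_in] by simp
  then have "r * card ?V \<le> r * s" by simp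
  moreover have "r * s + 1 \<le> card B" using card_B_ge A by (simp add: mult.commute)
  ultimately show False by linarith
qed

text \<open>Within \<open>B\<close> degrees are at most \<open>r - card Acc\<close>, as each
  accessible class takes a neighbor. Deleting \<open>y\<close> removes the surplus, so the sizes add
  up, and the strict bound on \<open>card B\<close> leaves enough vertices.\<close>

lemma recolor_B:
  assumes IH: "\<And>Y J q. Y \<subset> X \<Longrightarrow> J \<subseteq> I \<Longrightarrow> (\<And>x. x \<in> Y \<Longrightarrow> card (nbrs E Y x) \<le> q) \<Longrightarrow>
      s * (q + 1) \<le> card Y \<Longrightarrow> sum c J = card Y \<Longrightarrow> \<exists>g. sized_coloring E Y J c g"
    and y: "y \<in> B"
  shows "\<exists>g. sized_coloring E (B - {y}) (I - Acc) c g"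
proof (rule IH)
  have card: "card (B - {y}) + 1 = card B" using y fin_B by (metis Suc_eq_plus1 card.remove)
  then show "s * (r - card Acc + 1) \<le> card (B - {y})"
    using card_B_ge card_Acc_le by (simp add: Suc_diff_le)
  show "sum c (I - Acc) = card (B - {y})" using card card_B_eq by simp
  show "card (nbrs E (B - {y}) x) \<le> r - card Acc" if "x \<in> B - {y}" for x
  proof -
    have "card (nbrs E (B - {y}) x) \<le> card (nbrs E B x)"
      by (rule card_mono) (use fin_B in \<open>auto simp: nbrs_def\<close>)
    then show ?thesis using degree_B[of x] that by simp
  qed
qed (use y in \<open>auto simp: B_def\<close>)

end

section \<open>Terminal classes, solo edges and discharging\<close>

text \<open>The classes in \<open>T\<close> are terminal: all other accessible classes still reach \<open>v\<close> after the removal of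
  one class of \<open>T\<close>. Vertices colored from \<open>T\<close> can move to no accessible class outside \<open>T\<close> but
  \<open>U\<close>.\<close>

locale terminal_classes = stuck_coloring E X I c r s f v p
  for E :: "'a \<Rightarrow> 'a \<Rightarrow> bool" and X :: "'a set" and I :: "'c set" and c r s f v p +
  fixes U :: 'c and T :: "'c set"
  assumes U_in: "U \<in> Acc" and T_sub: "T \<subseteq> Acc - {U, v}" and T_ne: "T \<noteq> {}"
    and T_closed: "\<And>i j. i \<in> T \<Longrightarrow> j \<in> Acc - {U} - T \<Longrightarrow> (i, j) \<notin> move_rel E X f"
    and terminal: "\<And>W i. W \<in> T \<Longrightarrow> i \<in> Acc - {W} \<Longrightarrow>
      (i, v) \<in> (move_rel E X f \<inter> {(i, j). i \<noteq> W \<and> j \<noteq> W})\<^sup>*"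
begin

text \<open>A vertex of \<open>B\<close> has at most \<open>q - 1\<close> neighbors in
  \<open>B\<close>, and \<open>card B\<close> exceeds \<open>s * q\<close>.\<close>

abbreviation q :: nat where "q \<equiv> r + 1 - card Acc"

text \<open>The solo edges of Kierstead and Kostochka, taken at terminal classes only. If
  \<open>z\<close> leaves its class, \<open>y\<close> can take its place.\<close>

definition solo :: "'a \<Rightarrow> 'a \<Rightarrow> bool" where
  "solo y z \<longleftrightarrow> y \<in> B \<and> z \<in> X \<and> f z \<in> T \<and> N y (f z) = {z}"

lemma T_Acc: "i \<in> T \<Longrightarrow> i \<in> Acc"
  using T_sub by blast

lemma fin_T: "finite T"
  using T_sub fin_Acc finite_subset by blast

lemma solo_adj: "solo y z \<Longrightarrow> E y z"
  by (auto simp: solo_def N_def)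

text \<open>By \<open>T_closed\<close>, \<open>x\<close> has a neighbor in each of the
  \<open>card Acc - 1 - card T\<close> accessible classes outside \<open>T\<close> and different
  from \<open>U\<close>.\<close>

lemma degree_T:
  assumes "x \<in> X" "f x \<in> T"
  shows "card (nbrs E B x) \<le> q + card T"
proof -
  have "card (Acc - {U} - T) \<le> (\<Sum>i\<in>Acc - {U} - T. card (N x i))"
  proof -
    have "1 \<le> card (N x i)" if "i \<in> Acc - {U} - T" for i
    proof -
      have "\<not> movable E X f x i"
        using T_closed[OF assms(2) that] assms(1) by (auto simp: move_rel_def)
      then have "N x i \<noteq> {}" using that assms by (auto simp: movable_def N_def)
      then show ?thesis using fin_N by (simp add: Suc_le_eq card_gt_0_iff)
    qed
    then show ?thesis using sum_mono[of "Acc - {U} - T" "\<lambda>_. 1" "\<lambda>i. card (N x i)"] by simp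
  qed
  also have "\<dots> \<le> (\<Sum>i\<in>Acc. card (N x i))"
    by (rule sum_mono2) (use fin_Acc in auto)
  finally have "card (nbrs E B x) + card (Acc - {U} - T) \<le> r"
    using degree_split[OF assms(1)] by simp
  moreover have "card (Acc - {U} - T) = card (Acc - {U}) - card T"
    by (rule card_Diff_subset) (use T_sub fin_T in auto)
  moreover have "card (Acc - {U}) + 1 = card Acc"
    using U_in fin_Acc by (metis Suc_eq_plus1 card.remove)
  ultimately show ?thesis by linarith
qed

text \<open>Each accessible class contains a neighbor of \<open>y\<close>, and each class of
  \<open>T\<close> without a solo neighbor contains at least two. Comparing with the degree bound
  \<open>r\<close> gives the inequality.\<close>

lemma card_solo_ge:
  assumes y: "y \<in> B"
  shows "card T + card (nbrs E B y) + 1 \<le> q + card {z. solo y z}"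
proof -
  define T1 where "T1 = {i \<in> T. card (N y i) = 1}"
  have "T1 \<subseteq> f ` {z. solo y z}"
  proof
    fix i assume "i \<in> T1"
    then have i: "card (N y i) = 1" "i \<in> T" by (simp_all add: T1_def)
    then obtain z where z: "N y i = {z}" by (meson card_1_singletonE)
    then have "z \<in> N y i" by simp
    then have "f z = i" "z \<in> X" by (simp_all add: N_def)
    then have "solo y z" using y z i(2) by (simp add: solo_def)
    then show "i \<in> f ` {z. solo y z}" using \<open>f z = i\<close> by blast
  qed
  moreover have "finite {z. solo y z}"
    using finite_subset[OF _ fin_X] by (auto simp: solo_def)
  ultimately have "card T1 \<le> card {z. solo y z}"
    by (rule surj_card_le[rotated])
  moreover have "card T = card T1 + card (T - T1)"
    using fin_T by (subst card_Un_disjoint[symmetric]) (auto simp: T1_def intro: arg_cong[of _ _ card])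
  moreover have "card Acc + card (T - T1) \<le> (\<Sum>i\<in>Acc. card (N y i))"
  proof -
    have "card Acc + card (T - T1) = (\<Sum>i\<in>Acc. 1 + of_bool (i \<in> T - T1))"
    proof -
      have "Acc \<inter> {i. i \<in> T - T1} = T - T1" using T_sub by auto
      then have "(\<Sum>i\<in>Acc. of_bool (i \<in> T - T1)) = card (T - T1)"
        using fin_Acc by (metis of_nat_id sum_of_bool_eq)
      then show ?thesis unfolding sum.distrib by simp
    qed
    also have "\<dots> \<le> (\<Sum>i\<in>Acc. card (N y i))"
    proof (rule sum_mono)
      fix i assume "i \<in> Acc"
      then have "1 \<le> card (N y i)" using card_N_pos y by blast
      then show "1 + of_bool (i \<in> T - T1) \<le> card (N y i)"
        by (auto simp: T1_def)
    qed
    finally show ?thesis .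
  qed
  moreover have "card (nbrs E B y) + (\<Sum>i\<in>Acc. card (N y i)) \<le> r"
    using degree_split y by (simp add: B_def)
  ultimately show ?thesis using card_Acc_le by linarith
qed

text \<open>Each of the other \<open>card Acc - 1\<close> accessible classes blocks \<open>z\<close>
  with a neighbor.\<close>

lemma degree_unmovable:
  assumes z: "z \<in> X" "f z \<in> Acc" and stay: "\<And>j. j \<in> Acc \<Longrightarrow> \<not> movable E X f z j"
  shows "card (nbrs E B z) \<le> q"
proof -
  have "1 \<le> card (N z i)" if "i \<in> Acc - {f z}" for i
  proof -
    have "N z i \<noteq> {}" using that z stay[of i] by (auto simp: movable_def N_def)
    then show ?thesis using fin_N by (simp add: Suc_le_eq card_gt_0_iff)
  qed
  then have "card (Acc - {f z}) \<le> (\<Sum>i\<in>Acc - {f z}. card (N z i))"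
    using sum_mono[of "Acc - {f z}" "\<lambda>_. 1" "\<lambda>i. card (N z i)"] by simp
  also have "\<dots> \<le> (\<Sum>i\<in>Acc. card (N z i))"
    by (rule sum_mono2) (use fin_Acc in auto)
  finally have "card (nbrs E B z) + card (Acc - {f z}) \<le> r"
    using degree_split[OF z(1)] by simp
  moreover have "card (Acc - {f z}) + 1 = card Acc"
    using z(2) fin_Acc by (metis Suc_eq_plus1 card.remove)
  ultimately show ?thesis by linarith
qed

text \<open>Count the edges between \<open>B\<close> and class \<open>W\<close>, split into the solo
  vertices \<open>S\<close> and the rest \<open>D\<close>. At most \<open>q * card S\<close>
  vertices of \<open>B\<close> see \<open>S\<close>; all others have two neighbors in
  \<open>D\<close>, where degrees into \<open>B\<close> are at most \<open>q + card T\<close>. Since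
  \<open>card B > s * q\<close>, the assumption \<open>card T \<le> q\<close> would make these edges
  too few.\<close>

lemma q_less_card_T:
  assumes W: "W \<in> T"
    and stay: "\<And>y z j. solo y z \<Longrightarrow> f z = W \<Longrightarrow> j \<in> Acc \<Longrightarrow> \<not> movable E X f z j"
  shows "q < card T"
proof -
  define S where "S = {z \<in> X. f z = W \<and> (\<exists>y. solo y z)}"
  define D where "D = color_class X f W - S"
  define M where "M = {y \<in> B. \<exists>z\<in>S. E y z}"
  have fin: "finite S" "finite D" "finite M"
    using fin_X fin_B by (auto simp: S_def D_def M_def color_class_def)
  have "card (nbrs E B z) \<le> q" if "z \<in> S" for z
    using degree_unmovable that stay T_Acc[OF W] by (auto simp: S_def)
  then have "1 * card M \<le> q * card S"
    using fin
  proof (intro double_counting_le)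
    show "1 \<le> card {x \<in> S. E x y}" if "y \<in> M" for y
      using that fin sym by (auto simp: M_def Suc_le_eq card_gt_0_iff)
    show "card {y \<in> M. E x y} \<le> q" if "x \<in> S" "\<And>z. z \<in> S \<Longrightarrow> card (nbrs E B z) \<le> q" for x
    proof -
      have "card {y \<in> M. E x y} \<le> card (nbrs E B x)"
        by (rule card_mono) (use fin_B in \<open>auto simp: M_def nbrs_def\<close>)
      then show ?thesis using that by fastforce
    qed
  qed
  moreover have "2 * card (B - M) \<le> (q + card T) * card D"
  proof (rule double_counting_le)
    show "2 \<le> card {x \<in> D. E x y}" if "y \<in> B - M" for y
    proof -
      have y: "y \<in> B" using that by simp
      have "{x \<in> D. E x y} = N y W"
        using that by (auto simp: D_def M_def N_def color_class_def sym)
      moreover have "card (N y W) \<noteq> 1"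
      proof
        assume "card (N y W) = 1"
        then obtain z where z: "N y W = {z}" by (meson card_1_singletonE)
        then have "z \<in> N y W" by simp
        then have zW: "f z = W" "z \<in> X" by (simp_all add: N_def)
        then have "solo y z" using z y W by (simp add: solo_def)
        moreover from this have "z \<in> S" using zW by (auto simp: S_def)
        ultimately have "solo y z" "z \<in> S" .
        then show False using that solo_adj by (auto simp: M_def)
      qed
      ultimately show ?thesis using card_N_pos[OF y T_Acc[OF W]] by simp
    qed
    show "card {y \<in> B - M. E x y} \<le> q + card T" if "x \<in> D" for x
    proof -
      have "x \<in> X" "f x \<in> T" using that W by (auto simp: D_def color_class_def)
      moreover have "card {y \<in> B - M. E x y} \<le> card (nbrs E B x)"
        by (rule card_mono) (use fin_B in \<open>auto simp: nbrs_def\<close>)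
      ultimately show ?thesis using degree_T by fastforce
    qed
  qed (use fin fin_B in auto)
  moreover have "card B = card M + card (B - M)"
    using fin fin_B card_mono[of B M] by (simp add: card_Diff_subset M_def)
  moreover have "card (color_class X f W) = card S + card D"
  proof -
    have "S \<subseteq> color_class X f W" by (auto simp: S_def color_class_def)
    then show ?thesis unfolding D_def
      using fin fin_X card_mono[of "color_class X f W" S]
      by (simp add: card_Diff_subset color_class_def)
  qed
  then have "q * card S + q * card D \<le> s * q"
    using card_color_class_le[OF T_Acc[OF W]]
    by (metis distrib_left mult.commute mult_le_mono2)
  ultimately have "2 * (q * card D) + 2 \<le> (q + card T) * card D"
    using card_B_ge by linarith
  moreover have "(q + card T) * card D \<le> 2 * (q * card D)" if "card T \<le> q"
    unfolding mult.assoc[symmetric] by (rule mult_le_mono1) (use that in linarith)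
  ultimately show ?thesis by linarith
qed

text \<open>If the special neighbors of every solo vertex \<open>z\<close> formed a clique, giving weight
  \<open>1 / card {y. solo y z}\<close> to each solo edge would yield total weight at most \<open>s * card T\<close>,
  while every vertex of \<open>B\<close> receives at least \<open>card T / q\<close>.\<close>

lemma good_solo_vertex:
  shows "(\<exists>y z j. solo y z \<and> j \<in> Acc \<and> movable E X f z j) \<or>
    (\<exists>y y' z. solo y z \<and> solo y' z \<and> y \<noteq> y' \<and> \<not> E y y' \<and> (\<forall>j\<in>Acc. \<not> movable E X f z j))"
    (is "?movable \<or> ?nonadjacent")
proof (rule ccontr)
  assume neg: "\<not> (?movable \<or> ?nonadjacent)"
  then have stay: "\<not> movable E X f z j" if "solo y z" "j \<in> Acc" for y z j
    using that by blast
  have clique: "E y y'" if "solo y z" "solo y' z" "y \<noteq> y'" for y y' z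
    using neg that stay by blast
  obtain W where "W \<in> T" using T_ne by blast
  then have qT: "q < card T" using q_less_card_T stay by blast
  have q0: "q > 0" using card_Acc_le by simp
  define A where "A = {z \<in> X. f z \<in> T}"
  define w :: "'a \<Rightarrow> real" where "w z = 1 / card {y \<in> B. solo y z}" for z
  have fin_A: "finite A" using fin_X by (simp add: A_def)
  have "real (card B) * (card T / q) \<le> (\<Sum>y\<in>B. \<Sum>z\<in>{z \<in> A. solo y z}. w z)"
  proof -
    have "card T / q \<le> (\<Sum>z\<in>{z \<in> A. solo y z}. w z)" if y: "y \<in> B" for y
    proof -
      \<comment> \<open>By \<open>clique\<close>, the solo partners of \<open>z\<close> other than
        \<open>y\<close> are neighbors of \<open>y\<close> in \<open>B\<close>, so at most
        \<open>b\<close> vertices share the weight of \<open>z\<close>.\<close>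
      define b where "b = card (nbrs E B y) + 1"
      have b: "0 < b" "b \<le> q" using degree_B[OF y] by (auto simp: b_def)
      have "1 / b \<le> w z" if "z \<in> {z \<in> A. solo y z}" for z
      proof -
        have z: "solo y z" using that by simp
        have "{y \<in> B. solo y z} \<subseteq> insert y (nbrs E B y)"
          using clique[OF z] by (auto simp: nbrs_def)
        then have "card {y \<in> B. solo y z} \<le> card (insert y (nbrs E B y))"
          by (rule card_mono[rotated]) (use fin_B in \<open>auto simp: nbrs_def\<close>)
        also have "\<dots> \<le> b" by (simp add: b_def card_insert_le_m1)
        finally have "card {y \<in> B. solo y z} \<le> b" .
        moreover have "card {y \<in> B. solo y z} > 0"
          using y z fin_B by (auto simp: card_gt_0_iff)
        ultimately show ?thesis by (simp add: w_def frac_le)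
      qed
      then have "card {z \<in> A. solo y z} * (1 / b) \<le> (\<Sum>z\<in>{z \<in> A. solo y z}. w z)"
        using sum_bounded_below[of "{z \<in> A. solo y z}" "1 / b" w] by simp
      moreover have "{z \<in> A. solo y z} = {z. solo y z}" by (auto simp: A_def solo_def)
      ultimately have sum: "real (card {z. solo y z}) / b \<le> (\<Sum>z\<in>{z \<in> A. solo y z}. w z)" by simp
      have "card T + b \<le> q + card {z. solo y z}"
        using card_solo_ge[OF y] by (simp add: b_def)
      then have "real (card T) + b - q \<le> card {z. solo y z}" by linarith
      then have "(real (card T) + b - q) / b \<le> real (card {z. solo y z}) / b"
        by (simp add: divide_right_mono)
      moreover have "card T / q \<le> (real (card T) + b - q) / b"
      proof -
        \<comment> \<open>The bound is \<open>(card T - q) / b + 1\<close>. As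
          \<open>q < card T\<close>, it is smallest at \<open>b = q\<close>, where it equals
          \<open>card T / q\<close>.\<close>
        have "(real (card T) - q) / q \<le> (real (card T) - q) / b"
          using qT b by (intro divide_left_mono) auto
        then show ?thesis using b q0 by (simp add: diff_divide_distrib add_divide_distrib)
      qed
      ultimately show ?thesis using sum by (meson order_trans)
    qed
    then show ?thesis using sum_bounded_below[of B "card T / q"] by fastforce
  qed
  also have "\<dots> = (\<Sum>z\<in>A. \<Sum>y\<in>{y \<in> B. solo y z}. w z)"
    by (rule sum.swap_restrict[OF fin_B fin_A])
  \<comment> \<open>A vertex \<open>z\<close> gives away total weight 1 if it has solo partners, and
    0 otherwise.\<close>
  also have "\<dots> \<le> (\<Sum>z\<in>A. 1)"
    by (rule sum_mono) (simp add: w_def)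
  also have "\<dots> = card A" by simp
  also have "card A \<le> card T * s"
  proof -
    have "card A = card (\<Union>i\<in>T. color_class X f i)"
      by (rule arg_cong[of _ _ card]) (auto simp: A_def color_class_def)
    also have "\<dots> = (\<Sum>i\<in>T. card (color_class X f i))"
      by (rule card_UN_disjoint) (use fin_T fin_X in \<open>auto simp: color_class_def\<close>)
    also have "\<dots> \<le> card T * s"
      using sum_bounded_above[of T _ s] card_color_class_le T_Acc by simp
    finally show ?thesis .
  qed
  finally have "real (card B) * (card T / q) \<le> real (card T * s)" by simp
  then have "real (card B) * card T \<le> real (card T * s * q)"
    using q0 by (simp add: field_simps)
  then have "card B * card T \<le> s * q * card T"
    by (simp flip: of_nat_mult add: mult_ac)
  then show False using qT card_B_ge by simp
qed

section \<open>Recoloring along a solo edge\<close>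

lemma avoiding_path_Acc:
  assumes "W \<in> T" "(k, v) \<in> (move_rel E X f \<inter> {(i, j). i \<noteq> W \<and> j \<noteq> W})\<^sup>*"
  shows "k \<in> Acc - {W}"
proof -
  have "(k, v) \<in> (move_rel E X f)\<^sup>*"
    using assms(2) by (rule rtrancl_mono[THEN subsetD, rotated]) simp
  moreover have "k \<noteq> W"
    using assms(2) by (rule converse_rtranclE) (use assms(1) T_sub in auto)
  ultimately show ?thesis by (simp add: accessible_def)
qed

text \<open>Since \<open>W\<close> is terminal, the vacancy can be shifted from \<open>v\<close> to
  \<open>j\<close> without touching class \<open>W\<close>. Then \<open>z\<close> moves to
  \<open>j\<close>, \<open>y\<close> replaces \<open>z\<close> in \<open>W\<close>, and
  \<open>g\<close> colors the rest of \<open>B\<close> with the exact sizes, which absorbs the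
  surplus.\<close>

lemma coloring_if_solo_movable:
  assumes solo: "solo y z" and j: "j \<in> Acc" and mov: "movable E X f z j"
    and g: "sized_coloring E (B - {y}) (I - Acc) c g"
  shows "\<exists>h. sized_coloring E X I c h"
proof -
  define W where "W = f z"
  have y: "y \<in> B" "y \<in> X" "f y \<notin> Acc" and z: "z \<in> X" "z \<notin> B"
    and W: "W \<in> T" "W \<in> Acc" "N y W = {z}"
    using solo T_Acc by (auto simp: solo_def B_def W_def)
  have jW: "j \<noteq> W" using mov by (auto simp: movable_def W_def)
  have yz: "y \<noteq> z" using y z by blast
  let ?R = "move_rel E X f \<inter> {(i, j). i \<noteq> W \<and> j \<noteq> W}"
  have path: "(j, v) \<in> ?R\<^sup>*" using terminal W j jW by blast
  obtain f' where f': "proper_on E X I f'"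
    and changed: "\<And>x. x \<in> X \<Longrightarrow> f' x \<noteq> f x \<Longrightarrow> (f x, v) \<in> ?R\<^sup>* \<and> (f' x, v) \<in> ?R\<^sup>*"
    and shrink: "\<And>x. x \<in> X \<Longrightarrow> f' x = j \<Longrightarrow> f x = j"
    and card_f': "\<And>k. card (color_class X f' k) + of_bool (k = j)
      = card (color_class X f k) + of_bool (k = v)"
    by (rule shift_along_path[OF fin_X _ _ proper v_in Int_lower1 path])
      (erule sym, rule irrefl, (rule that; blast))
  have changed_Acc: "f x \<in> Acc - {W} \<and> f' x \<in> Acc - {W}" if "x \<in> X" "f' x \<noteq> f x" for x
    using changed[OF that] avoiding_path_Acc[OF W(1)] by blast
  have f'_Acc: "f' x \<in> Acc \<longleftrightarrow> f x \<in> Acc" and f'_W: "f' x = W \<longleftrightarrow> f x = W" if "x \<in> X" for x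
    using changed_Acc[OF that] W by (cases "f' x = f x"; auto)+
  define h where "h x = (if x \<in> B - {y} then g x else if x = y then W else if x = z then j else f' x)" for x
  have h: "h y = W" "h z = j" "\<And>x. x \<in> B \<Longrightarrow> x \<noteq> y \<Longrightarrow> h x = g x"
    "\<And>x. x \<notin> B \<Longrightarrow> x \<noteq> z \<Longrightarrow> h x = f' x"
    using y z yz by (auto simp: h_def)
  have g_in: "g x \<in> I" "g x \<notin> Acc" if "x \<in> B" "x \<noteq> y" for x
    using g that by (auto simp: sized_coloring_def proper_on_def)
  have g_proper: "g x \<noteq> g x'" if "x \<in> B" "x \<noteq> y" "x' \<in> B" "x' \<noteq> y" "E x x'" for x x'
    using g that by (auto simp: sized_coloring_def proper_on_def)
  \<comment> \<open>\<open>B - {y}\<close> and its complement use disjoint sets of colors, so only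
    edges inside one of the two parts can cause a conflict.\<close>
  have h_Acc: "h x \<in> Acc \<longleftrightarrow> x \<notin> B - {y}" if "x \<in> X" for x
    using that h g_in W j f'_Acc[OF that] by (cases "x = y"; cases "x = z"; cases "x \<in> B") (auto simp: B_def)
  have y_W: "\<not> E y x" if "x \<in> X" "x \<noteq> z" "f' x = W" for x
  proof
    assume "E y x"
    then have "x \<in> N y W" using that f'_W by (simp add: N_def)
    then show False using W that by simp
  qed
  \<comment> \<open>The shift added no vertex to class \<open>j\<close>, so \<open>z\<close> may
    still enter it.\<close>
  have z_j: "\<not> E z x" if "x \<in> X" "f' x = j" for x
    using mov shrink that by (auto simp: movable_def)
  have "h x \<noteq> h x'" if x: "x \<in> X" "x' \<in> X" "E x x'" for x x'
  proof (cases "x \<in> B - {y} \<longleftrightarrow> x' \<in> B - {y}")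
    case False
    then show ?thesis using h_Acc x by metis
  next
    case same: True
    show ?thesis
    proof (cases "x \<in> B - {y}")
      case True
      then have "x' \<in> B - {y}" using same by blast
      then show ?thesis using True g_proper[of x x'] x h(3)[of x] h(3)[of x'] by simp
    next
      case False
      then have "x' \<notin> B - {y}" using same by blast
      moreover have "f' x \<noteq> f' x'" using f' x by (simp add: proper_on_def)
      moreover have "E x' x" using sym x by blast
      moreover have "h u = f' u" if "u \<notin> B - {y}" "u \<noteq> y" "u \<noteq> z" for u
        using h(4) that by blast
      moreover have "x \<noteq> x'" using irrefl x by blast
      ultimately show ?thesis using False x h(1,2) y_W[of x] y_W[of x'] z_j[of x] z_j[of x'] jW
        by (cases "x = y"; cases "x = z"; cases "x' = y"; cases "x' = z") auto
    qed
  qed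
  moreover have "h x \<in> I" if "x \<in> X" for x
    using h_Acc[OF that] Acc_subset g_in h by (cases "x \<in> B - {y}") auto
  moreover have "card (color_class X h i) = c i" if i: "i \<in> I" for i
  proof (cases "i \<in> Acc")
    case False
    then have "color_class X h i = color_class (B - {y}) g i"
      using h_Acc h by (auto simp: color_class_def B_def)
    then show ?thesis using g i False by (simp add: sized_coloring_def)
  next
    case True
    then have "i \<noteq> p" using p_not_Acc by blast
    then have sz: "card (color_class X f' i) + of_bool (i = j) = c i"
      using card_f'[of i] sizes[OF i] by simp
    have fin: "finite (color_class X f' i)" using fin_X by (simp add: color_class_def)
    have notB: "x \<notin> B" if "x \<in> X" "f' x = i" for x
      using f'_Acc that True by (auto simp: B_def)
    have notg: "g x \<noteq> i" if "x \<in> B" "x \<noteq> y" for x using g_in that True by blast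
    have zW: "f' z = W" using f'_W z by (simp add: W_def)
    consider "i = W" | "i = j" | "i \<noteq> W" "i \<noteq> j" by blast
    then show ?thesis
    proof cases
      case 1
      then have "color_class X h i = insert y (color_class X f' i - {z})"
        using notB notg y jW by (auto simp: color_class_def h_def)
      moreover have "z \<in> color_class X f' i" "y \<notin> color_class X f' i"
        using zW z notB y 1 by (auto simp: color_class_def)
      ultimately have "card (color_class X h i) = card (color_class X f' i)"
        using fin by (metis card_exchange)
      then show ?thesis using sz 1 jW by simp
    next
      case 2
      then have "color_class X h i = insert z (color_class X f' i)"
        using notB notg y z yz jW by (auto simp: color_class_def h_def)
      moreover have "z \<notin> color_class X f' i" using zW 2 jW by (auto simp: color_class_def)
      ultimately show ?thesis using sz 2 fin by simp
    next
      case 3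
      then have "color_class X h i = color_class X f' i"
        using notB notg y z yz jW zW by (auto simp: color_class_def h_def)
      then show ?thesis using sz 3 by simp
    qed
  qed
  ultimately have "sized_coloring E X I c h" by (simp add: sized_coloring_def proper_on_def)
  then show ?thesis by blast
qed

text \<open>Here \<open>y\<close> replaces \<open>z\<close> in \<open>W\<close>, \<open>g\<close>
  recolors the rest of \<open>B\<close>, and \<open>z\<close> goes to an inaccessible class
  \<open>k\<close>, the new surplus class. The old accessible classes stay accessible; in addition
  \<open>y'\<close> can now move to \<open>W\<close>, since its only neighbor there has left and it
  is not adjacent to \<open>y\<close>.\<close>

lemma better_near_coloring:
  assumes solo: "solo y z" "solo y' z" and yy': "y \<noteq> y'" "\<not> E y y'"
    and stay: "\<And>j. j \<in> Acc \<Longrightarrow> \<not> movable E X f z j"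
    and g: "sized_coloring E (B - {y}) (I - Acc) c g"
  shows "\<exists>h k. near_coloring E X I c r s h v k \<and> Acc \<subset> accessible E X h v"
proof -
  define W where "W = f z"
  have y: "y \<in> B" "y \<in> X" and y': "y' \<in> B" "y' \<in> X" and z: "z \<in> X" "z \<notin> B"
    and W: "W \<in> T" "W \<in> Acc" "N y W = {z}" "N y' W = {z}"
    using solo T_Acc by (auto simp: solo_def B_def W_def)
  have yz: "y \<noteq> z" using y z by blast
  have g_in: "g x \<in> I" "g x \<notin> Acc" if "x \<in> B" "x \<noteq> y" for x
    using g that by (auto simp: sized_coloring_def proper_on_def)
  have g_proper: "g x \<noteq> g x'" if "x \<in> B" "x \<noteq> y" "x' \<in> B" "x' \<noteq> y" "E x x'" for x x'
    using g that by (auto simp: sized_coloring_def proper_on_def)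
  \<comment> \<open>Of the at most \<open>q\<close> neighbors of \<open>z\<close> in
    \<open>B\<close>, one is \<open>y\<close>, which leaves its class. The others block fewer than
    \<open>q\<close> colors, while at least \<open>q\<close> colors are inaccessible.\<close>
  obtain k where k: "k \<in> I" "k \<notin> Acc" and k_free: "\<And>x. x \<in> B \<Longrightarrow> x \<noteq> y \<Longrightarrow> E z x \<Longrightarrow> g x \<noteq> k"
  proof -
    have "card (nbrs E B z) \<le> q" using degree_unmovable z W stay by (auto simp: W_def)
    moreover have "nbrs E B z = insert y (nbrs E (B - {y}) z)"
      using y solo_adj[OF solo(1)] sym by (auto simp: nbrs_def)
    moreover have fin: "finite (nbrs E (B - {y}) z)" using fin_B by (simp add: nbrs_def)
    ultimately have "card (nbrs E (B - {y}) z) + 1 \<le> q" by (simp add: nbrs_def)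
    moreover have "q \<le> card (I - Acc)"
    proof -
      have "z \<in> color_class X f W" using z by (simp add: color_class_def W_def)
      then have "0 < card (color_class X f W)"
        using fin_X by (auto simp: card_gt_0_iff color_class_def)
      then have "0 < s" using card_color_class_le[OF W(2)] by linarith
      have "sum c (I - Acc) \<le> s * card (I - Acc)"
        using sum_bounded_above[of "I - Acc" c s] c_le by (simp add: mult.commute)
      then have "s * q \<le> s * card (I - Acc)" using card_B_ge card_B_eq by linarith
      then show ?thesis using \<open>0 < s\<close> by simp
    qed
    moreover have "card (g ` nbrs E (B - {y}) z) \<le> card (nbrs E (B - {y}) z)"
      by (rule card_image_le[OF fin])
    ultimately have "card (g ` nbrs E (B - {y}) z) < card (I - Acc)" by linarith
    then obtain k where "k \<in> I - Acc" "k \<notin> g ` nbrs E (B - {y}) z"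
      using card_mono[of "g ` nbrs E (B - {y}) z" "I - Acc"] fin by (meson finite_imageI leD subsetI)
    then show ?thesis using that[of k] by (auto simp: nbrs_def)
  qed
  have kW: "k \<noteq> W" using k W by blast
  define h where "h x = (if x = z then k else if x = y then W else if x \<in> B then g x else f x)" for x
  have h: "h y = W" "h z = k" "\<And>x. x \<in> B \<Longrightarrow> x \<noteq> y \<Longrightarrow> h x = g x"
    "\<And>x. x \<notin> B \<Longrightarrow> x \<noteq> z \<Longrightarrow> h x = f x"
    using y z yz by (auto simp: h_def)
  \<comment> \<open>The vertices whose new color lies outside \<open>Acc\<close>; as before,
    conflicts are possible only within \<open>C\<close> or within its complement.\<close>
  define C where "C = insert z (B - {y})"
  have h_Acc: "h x \<in> Acc \<longleftrightarrow> x \<notin> C" if "x \<in> X" for x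
    using that h g_in W k yz
    by (cases "x = y"; cases "x = z"; cases "x \<in> B") (auto simp: B_def C_def)
  have only_z: "\<not> E u x" if "u = y \<or> u = y'" "x \<in> X" "x \<noteq> z" "f x = W" for u x
  proof
    assume "E u x"
    then have "x \<in> N y W \<or> x \<in> N y' W" using that by (auto simp: N_def)
    then show False using W that by simp
  qed
  have h_proper: "h x \<noteq> h x'" if x: "x \<in> X" "x' \<in> X" "E x x'" for x x'
  proof (cases "x \<in> C \<longleftrightarrow> x' \<in> C")
    case False
    then show ?thesis using h_Acc x by metis
  next
    case same: True
    have x': "E x' x" using sym x by blast
    show ?thesis
    proof (cases "x \<in> C")
      case True
      then have C: "x \<in> C" "x' \<in> C" using same by simp_all
      have z_k: "g u \<noteq> k" if "u \<in> C" "u \<noteq> z" "E z u" for u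
        using that k_free by (auto simp: C_def)
      have hC: "h u = g u" if "u \<in> C" "u \<noteq> z" for u
        using that h by (auto simp: C_def)
      consider "x = z" "x' \<noteq> z" | "x \<noteq> z" "x' = z" | "x \<noteq> z" "x' \<noteq> z"
        using x irrefl by blast
      then show ?thesis
      proof cases
        case 1
        then show ?thesis using z_k[of x'] hC[of x'] h(2) C x by simp
      next
        case 2
        then show ?thesis using z_k[of x] hC[of x] h(2) C x' by simp
      next
        case 3
        then show ?thesis using g_proper[of x x'] hC[of x] hC[of x'] C x by (auto simp: C_def)
      qed
    next
      case False
      then have C: "x \<notin> C" "x' \<notin> C" using same by simp_all
      have hA: "h u = f u" "u \<noteq> z" if "u \<notin> C" "u \<noteq> y" for u
        using that h by (auto simp: C_def)
      consider "x = y" "x' \<noteq> y" | "x \<noteq> y" "x' = y" | "x \<noteq> y" "x' \<noteq> y"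
        using x irrefl by blast
      then show ?thesis
      proof cases
        case 1
        then show ?thesis using only_z[of y x'] hA[of x'] h(1) C x by auto
      next
        case 2
        then show ?thesis using only_z[of y x] hA[of x] h(1) C x x' by auto
      next
        case 3
        then show ?thesis using f_proper[of x x'] hA[of x] hA[of x'] C x by simp
      qed
    qed
  qed
  have "near_coloring E X I c r s h v k"
  proof unfold_locales
    show "proper_on E X I h"
    proof -
      have "h x \<in> I" if "x \<in> X" for x
        using h_Acc[OF that] Acc_subset g_in h k by (cases "x \<in> C") (auto simp: C_def)
      then show ?thesis using h_proper by (simp add: proper_on_def)
    qed
    show "card (color_class X h i) + of_bool (i = v) = c i + of_bool (i = k)" if i: "i \<in> I" for i
    proof (cases "i \<in> Acc")
      case False
      have BX: "B \<subseteq> X" by (auto simp: B_def)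
      have "card (color_class (B - {y}) g i) = c i" using g i False by (simp add: sized_coloring_def)
      moreover have "color_class X h i
          = (if i = k then insert z (color_class (B - {y}) g i) else color_class (B - {y}) g i)"
      proof -
        have "h u = i \<longleftrightarrow> u = z \<and> i = k \<or> u \<in> B - {y} \<and> g u = i" if "u \<in> X" for u
          using h_Acc[OF that] h(2) h(3)[of u] z(2) False by (auto simp: C_def)
        then show ?thesis using z(1) BX by (auto simp: color_class_def)
      qed
      moreover have "i \<noteq> v" using False v_Acc by blast
      ultimately show ?thesis using z fin_B by (auto simp: color_class_def)
    next
      case True
      then have ip: "i \<noteq> p" "i \<noteq> k" using p_not_Acc k by auto
      have "card (color_class X h i) = card (color_class X f i)"
      proof (cases "i = W")
        case True
        have "color_class X h i = insert y (color_class X f i - {z})"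
          using True W g_in y yz kW by (auto simp: color_class_def h_def B_def)
        moreover have "z \<in> color_class X f i" "y \<notin> color_class X f i"
          using z y True W by (auto simp: color_class_def W_def B_def)
        moreover have "finite (color_class X f i)" using fin_X by (simp add: color_class_def)
        ultimately show ?thesis by (metis card_exchange)
      next
        case False
        have "color_class X h i = color_class X f i"
          using False True ip W g_in y by (auto simp: color_class_def h_def B_def W_def)
        then show ?thesis by simp
      qed
      then show ?thesis using sizes[OF i] ip by simp
    qed
  qed (fact fin_X fin_I sym irrefl degree c_le large sum_c v_in k(1))+
  moreover
  let ?Acc' = "accessible E X h v"
  \<comment> \<open>The only accessible class that gains a vertex is \<open>W\<close>, so a move
    into any other one remains possible.\<close>
  have move: "(f x, j) \<in> move_rel E X h"
    if "x \<in> X" "f x \<in> Acc" "x \<noteq> z" "j \<in> Acc - {W}" "movable E X f x j" for x j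
  proof -
    have x: "h x = f x" using h that by (simp add: B_def)
    have "h u \<noteq> j" if u: "u \<in> X" "E x u" for u
    proof
      assume hu: "h u = j"
      then have "u \<notin> C" "u \<noteq> y" using h_Acc[OF u(1)] \<open>j \<in> Acc - {W}\<close> h by auto
      then have "f u = j" using h hu by (auto simp: C_def)
      then show False using \<open>movable E X f x j\<close> u by (auto simp: movable_def)
    qed
    then have "movable E X h x j" using that x by (auto simp: movable_def)
    then show ?thesis using that x by (force simp: move_rel_def)
  qed
  have move_Acc: "i \<in> ?Acc'" if "(i, j) \<in> move_rel E X h" "j \<in> ?Acc'" for i j
    using that by (auto simp: accessible_def intro: converse_rtrancl_into_rtrancl)
  have Acc_W: "i \<in> ?Acc'" if "i \<in> Acc - {W}" for i
    using terminal[OF W(1) that]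
  proof (induction rule: converse_rtrancl_induct)
    case base
    then show ?case by (simp add: accessible_def)
  next
    case (step i j)
    then obtain x where x: "x \<in> X" "f x = i" "movable E X f x j" "i \<noteq> W"
      by (auto simp: move_rel_def)
    have j: "j \<in> Acc - {W}" using avoiding_path_Acc[OF W(1) step.hyps(2)] .
    then have "f x \<in> Acc" using Acc_step x by blast
    then have "(i, j) \<in> move_rel E X h" using move[of x j] x j by (auto simp: W_def)
    then show ?case using step.IH move_Acc by blast
  qed
  \<comment> \<open>The vertex that allowed a move out of \<open>W\<close> is not \<open>z\<close>,
    which is unmovable, so it is still in \<open>W\<close>.\<close>
  have W_Acc: "W \<in> ?Acc'"
  proof -
    have "(W, v) \<in> (move_rel E X f)\<^sup>*" "W \<noteq> v" using W T_sub by (auto simp: accessible_def)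
    then obtain j where "(W, j) \<in> move_rel E X f" "j \<in> Acc"
      by (auto simp: accessible_def elim: converse_rtranclE)
    then obtain x where x: "x \<in> X" "f x = W" "movable E X f x j" by (auto simp: move_rel_def)
    moreover have "x \<noteq> z" using stay \<open>j \<in> Acc\<close> x by blast
    moreover have "j \<in> Acc - {W}" using \<open>j \<in> Acc\<close> x by (auto simp: movable_def)
    ultimately show ?thesis using move[of x j] Acc_W move_Acc W by auto
  qed
  have "h y' \<in> ?Acc'"
  proof (rule move_Acc[OF _ W_Acc])
    have "h y' = g y'" "g y' \<notin> Acc" using h y' yy' g_in by auto
    moreover have "h u \<noteq> W" if u: "u \<in> X" "E y' u" for u
    proof
      assume hu: "h u = W"
      have "u \<noteq> y" using yy' sym u by blast
      moreover have "u \<notin> C" using h_Acc[OF u(1)] hu W by auto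
      ultimately have "f u = W" "u \<noteq> z" using hu h by (auto simp: C_def)
      then show False using only_z[of y' u] u by blast
    qed
    ultimately have "movable E X h y' W" using W by (auto simp: movable_def)
    then show "(h y', W) \<in> move_rel E X h" using y' by (force simp: move_rel_def)
  qed
  moreover have "h y' \<notin> Acc" using h y' yy' g_in by auto
  ultimately show ?thesis using Acc_W W_Acc by blast
qed

end

section \<open>The nested inductions\<close>

text \<open>Induction on the number of inaccessible classes, with \<open>v\<close> fixed and the
  surplus class varying: each round either finishes or enlarges the accessible set.
  \<open>IH\<close> comes from the outer induction on the vertex set.\<close>

lemma near_coloring_imp_sized_coloring:
  assumes near: "near_coloring E X I c r s f v p"
    and IH: "\<And>Y J q. Y \<subset> X \<Longrightarrow> J \<subseteq> I \<Longrightarrow> (\<And>x. x \<in> Y \<Longrightarrow> card (nbrs E Y x) \<le> q) \<Longrightarrow>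
      s * (q + 1) \<le> card Y \<Longrightarrow> sum c J = card Y \<Longrightarrow> \<exists>g. sized_coloring E Y J c g"
  shows "\<exists>g. sized_coloring E X I c g"
  using near
proof (induction "card (I - accessible E X f v)" arbitrary: f p rule: less_induct)
  case less
  interpret near_coloring E X I c r s f v p by (rule less.prems)
  show ?case
  proof (cases "p \<in> Acc")
    case True
    then show ?thesis by (rule coloring_if_accessible)
  next
    case False
    then interpret stuck_coloring E X I c r s f v p by unfold_locales
    have "\<And>i. i \<in> Acc \<Longrightarrow> (i, v) \<in> (move_rel E X f)\<^sup>*" by (simp add: accessible_def)
    then obtain U T where UT: "U \<in> Acc" "T \<subseteq> Acc - {U, v}" "T \<noteq> {}"
      "\<And>i j. i \<in> T \<Longrightarrow> j \<in> Acc - {U} - T \<Longrightarrow> (i, j) \<notin> move_rel E X f"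
      "\<And>W i. W \<in> T \<Longrightarrow> i \<in> Acc - {W} \<Longrightarrow>
        (i, v) \<in> (move_rel E X f \<inter> {(i, j). i \<noteq> W \<and> j \<noteq> W})\<^sup>*"
      using exists_terminal_set[OF fin_Acc _ v_Acc Acc_not_singleton, of "move_rel E X f"] by blast
    then interpret terminal_classes E X I c r s f v p U T by unfold_locales
    have recolor: "\<exists>g. sized_coloring E (B - {y}) (I - Acc) c g" if "solo y z" for y z
    proof -
      have "y \<in> B" using that by (simp add: solo_def)
      then show ?thesis by (rule recolor_B[rotated]) (fact IH)
    qed
    from good_solo_vertex show ?thesis
    proof (elim disjE exE conjE)
      fix y z j assume *: "solo y z" "j \<in> Acc" "movable E X f z j"
      then show ?thesis using coloring_if_solo_movable recolor by blast
    next
      fix y y' z assume *: "solo y z" "solo y' z" "y \<noteq> y'" "\<not> E y y'"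
        "\<forall>j\<in>Acc. \<not> movable E X f z j"
      obtain g where "sized_coloring E (B - {y}) (I - Acc) c g" using recolor[OF *(1)] ..
      then obtain h k where h: "near_coloring E X I c r s h v k" "Acc \<subset> accessible E X h v"
        using better_near_coloring[OF *(1-4)] *(5) by blast
      have "accessible E X h v \<subseteq> I" using near_coloring.Acc_subset[OF h(1)] .
      then have "I - accessible E X h v \<subset> I - Acc" using h(2) by blast
      then have "card (I - accessible E X h v) < card (I - Acc)"
        using fin_I by (simp add: psubset_card_mono)
      then show ?thesis using less.hyps h(1) by blast
    qed
  qed
qed

lemma ex_function_with_class_sizes:
  assumes "finite I" "finite X" "sum c I = card X"
  shows "\<exists>g. (\<forall>x\<in>X. g x \<in> I) \<and> (\<forall>i\<in>I. card (color_class X g i) = c i)"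
  using assms
proof (induction I arbitrary: X rule: finite_induct)
  case empty
  then show ?case by simp
next
  case (insert i I)
  then have "c i \<le> card X" by simp
  then obtain Y where Y: "Y \<subseteq> X" "card Y = c i" using obtain_subset_with_card_n by metis
  have "finite Y" using Y insert.prems finite_subset by blast
  then have "sum c I = card (X - Y)" using insert Y by (simp add: card_Diff_subset)
  then obtain g where g: "\<forall>x\<in>X - Y. g x \<in> I" "\<forall>k\<in>I. card (color_class (X - Y) g k) = c k"
    using insert.IH[of "X - Y"] insert.prems by auto
  define h where "h x = (if x \<in> Y then i else g x)" for x
  have "color_class X h i = Y"
    using g Y insert.hyps by (auto simp: color_class_def h_def)
  moreover have "color_class X h k = color_class (X - Y) g k" if "k \<in> I" for k
    using that Y insert.hyps by (auto simp: color_class_def h_def)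
  ultimately have "card (color_class X h k) = c k" if "k \<in> insert i I" for k
    using g Y that by auto
  moreover have "h x \<in> insert i I" if "x \<in> X" for x
    using g that by (simp add: h_def)
  ultimately show ?case by blast
qed

lemma sized_coloring_exists:
  assumes "finite X" "finite I"
    and "\<And>x y. E x y \<Longrightarrow> E y x" "\<And>x. \<not> E x x"
    and "\<And>x. x \<in> X \<Longrightarrow> card (nbrs E X x) \<le> r"
    and "\<And>i. i \<in> I \<Longrightarrow> c i \<le> s" "s * (r + 1) \<le> card X" "sum c I = card X"
  shows "\<exists>g. sized_coloring E X I c g"
  using assms
\<comment> \<open>\<open>E\<close> and \<open>r\<close> vary because the hypothesis is later applied
  to a subset of \<open>X\<close> with only some of the edges and a smaller degree bound.\<close>
proof (induction "card X" arbitrary: E X I r rule: less_induct)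
  case less
  \<comment> \<open>Vertices outside \<open>S\<close> are kept as isolated vertices, so the sizes
    and the bound on \<open>card X\<close> hold throughout the inner induction.\<close>
  define E' where "E' S x y \<longleftrightarrow> E x y \<and> x \<in> S \<and> y \<in> S" for S x y
  have "\<exists>g. sized_coloring (E' S) X I c g" if "S \<subseteq> X" for S
    using finite_subset[OF that less.prems(1)] that
  proof (induction S rule: finite_induct)
    case empty
    then show ?case
      using ex_function_with_class_sizes[OF less.prems(2,1,8)]
      by (simp add: sized_coloring_def proper_on_def E'_def)
  next
    case (insert u S)
    then obtain g where g: "sized_coloring (E' S) X I c g" by blast
    let ?E = "E' (insert u S)"
    have u: "u \<in> X" using insert by simp
    have deg: "card (nbrs ?E X x) \<le> r" if "x \<in> X" for x
    proof -
      have "card (nbrs ?E X x) \<le> card (nbrs E X x)"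
        by (rule card_mono) (use less.prems(1) in \<open>auto simp: nbrs_def E'_def\<close>)
      then show ?thesis using less.prems(5)[OF that] by simp
    qed
    \<comment> \<open>At most \<open>r\<close> colors occur on neighbors of \<open>u\<close>. Since
      \<open>X\<close> is nonempty, \<open>s\<close> is positive, and
      \<open>s * (r + 1) \<le> card X \<le> s * card I\<close> yields at least \<open>r + 1\<close>
      colors.\<close>
    obtain j where j: "j \<in> I" "\<And>x. x \<in> X \<Longrightarrow> ?E u x \<Longrightarrow> g x \<noteq> j"
    proof -
      have fin: "finite (nbrs ?E X u)" using less.prems(1) by (simp add: nbrs_def)
      have "card (g ` nbrs ?E X u) \<le> r"
        using card_image_le[OF fin, of g] deg[OF u] by simp
      moreover have "r + 1 \<le> card I"
      proof -
        have "card X \<le> s * card I"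
          using sum_bounded_above[of I c s] less.prems(6,8) by (simp add: mult.commute)
        moreover have "0 < card X" using u less.prems(1) by (auto simp: card_gt_0_iff)
        ultimately have "0 < s" "s * (r + 1) \<le> s * card I"
          using less.prems(7) by (auto intro: gr0I)
        then show ?thesis using mult_le_cancel1 by metis
      qed
      ultimately have "card (g ` nbrs ?E X u) < card I" by linarith
      then obtain j where "j \<in> I" "j \<notin> g ` nbrs ?E X u"
        using card_mono[of "g ` nbrs ?E X u" I] fin by (meson finite_imageI leD subsetI)
      then show ?thesis using that by (auto simp: nbrs_def)
    qed
    have gI: "\<And>x. x \<in> X \<Longrightarrow> g x \<in> I"
      and gp: "\<And>x y. x \<in> X \<Longrightarrow> y \<in> X \<Longrightarrow> E' S x y \<Longrightarrow> g x \<noteq> g y"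
      and gc: "\<And>i. i \<in> I \<Longrightarrow> card (color_class X g i) = c i"
      using g by (auto simp: sized_coloring_def proper_on_def)
    have symE: "?E x y \<Longrightarrow> ?E y x" for x y using less.prems(3) by (auto simp: E'_def)
    have irrE: "\<not> ?E x x" for x using less.prems(4) by (simp add: E'_def)
    have ES: "E' S x y" if "?E x y" "x \<noteq> u" "y \<noteq> u" for x y using that by (simp add: E'_def)
    \<comment> \<open>Recoloring \<open>u\<close> from \<open>g u\<close> to the free color
      \<open>j\<close> repairs all new edges at once, leaving a gap at \<open>g u\<close> and a
      surplus at \<open>j\<close>; these cancel if \<open>j = g u\<close>.\<close>
    have "near_coloring ?E X I c r s (g(u := j)) (g u) j"
    proof
      show "proper_on ?E X I (g(u := j))"
        unfolding proper_on_def
      proof (intro conjI ballI impI)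
        show "(g(u := j)) x \<in> I" if "x \<in> X" for x using that gI j by simp
        show "(g(u := j)) x \<noteq> (g(u := j)) y" if "x \<in> X" "y \<in> X" "?E x y" for x y
          using that gp[of x y] ES[of x y] j(2)[of x] j(2)[of y] symE[of x y] irrE[of u]
          by (cases "x = u"; cases "y = u") auto
      qed
      show "card (color_class X (g(u := j)) i) + of_bool (i = g u) = c i + of_bool (i = j)"
        if i: "i \<in> I" for i
      proof -
        have fin: "finite (color_class X g i)" using less.prems(1) by (simp add: color_class_def)
        consider "j = g u" | "j \<noteq> g u" "i = g u" | "j \<noteq> g u" "i = j" | "i \<noteq> g u" "i \<noteq> j" by blast
        then show ?thesis
        proof cases
          case 1
          then show ?thesis using gc[OF i] by (simp add: fun_upd_idem)
        next
          case 2
          have "color_class X g i = insert u (color_class X (g(u := j)) i)"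
            "u \<notin> color_class X (g(u := j)) i"
            using 2 u by (auto simp: color_class_def)
          then show ?thesis using gc[OF i] 2 fin by simp
        next
          case 3
          have "color_class X (g(u := j)) i = insert u (color_class X g i)"
            "u \<notin> color_class X g i"
            using 3 u by (auto simp: color_class_def)
          then show ?thesis using gc[OF i] 3 fin by simp
        next
          case 4
          have "color_class X (g(u := j)) i = color_class X g i"
            using 4 by (auto simp: color_class_def)
          then show ?thesis using gc[OF i] 4 by simp
        qed
      qed
    qed (fact less.prems deg symE irrE gI[OF u] j(1))+
    then show ?case
    proof (rule near_coloring_imp_sized_coloring)
      fix Y J q
      assume Y: "Y \<subset> X" and J: "J \<subseteq> I" and q: "\<And>x. x \<in> Y \<Longrightarrow> card (nbrs ?E Y x) \<le> q"
        and l: "s * (q + 1) \<le> card Y" "sum c J = card Y"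
      show "\<exists>g. sized_coloring ?E Y J c g"
      proof (rule less.hyps[OF _ _ _ symE irrE q _ l])
        show "card Y < card X" using Y less.prems(1) by (rule psubset_card_mono[rotated])
        show "finite Y" "finite J" using Y J less.prems(1,2) by (auto intro: finite_subset)
      qed (use J less.prems(6) in auto)
    qed
  qed
  from this[of X] obtain g where "sized_coloring (E' X) X I c g" by blast
  then show ?case by (auto simp: sized_coloring_def proper_on_def E'_def)
qed

section \<open>Transfer to finite simple graphs\<close>

theorem theorem1:
  fixes G :: "('a, 'b) pre_digraph" and r n d :: nat and c :: "nat \<Rightarrow> nat"
  assumes "graph G"
    and "card (verts G) = n"
    and "max_degree G \<le> r"
    and "color_vector n d c"
    and "\<forall>i\<in>{1..d}. c i \<le> n div (r + 1)"
  shows "\<exists>f. prescribed_coloring G d c f"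
proof -
  interpret graph G by (rule assms(1))
  let ?E = "\<lambda>u w. u \<rightarrow>\<^bsub>G\<^esub> w"
  have "\<exists>g. sized_coloring ?E (verts G) {1..d} c g"
  proof (rule sized_coloring_exists[where s = "n div (r + 1)" and r = r])
    show "card (nbrs ?E (verts G) x) \<le> r" if "x \<in> verts G" for x
    proof -
      \<comment> \<open>Degrees count outgoing arcs; every neighbor is the head of one, so there are
        no more neighbors than arcs.\<close>
      have "nbrs ?E (verts G) x \<subseteq> head G ` out_arcs G x"
        by (auto simp: nbrs_def arcs_ends_def arc_to_ends_def)
      then have "card (nbrs ?E (verts G) x) \<le> out_degree G x"
        unfolding out_degree_def
        using card_mono[OF finite_imageI] card_image_le finite_out_arcs le_trans by metis
      also have "\<dots> \<le> max_degree G"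
        unfolding max_degree_def using that by (intro Max_ge) auto
      finally show ?thesis using assms(3) by simp
    qed
    show "sum c {1..d} = card (verts G)" using assms by (simp add: color_vector_def)
    show "n div (r + 1) * (r + 1) \<le> card (verts G)" unfolding assms(2) by (rule div_times_less_eq_dividend)
    show "w \<rightarrow>\<^bsub>G\<^esub> u" if "u \<rightarrow>\<^bsub>G\<^esub> w" for u w
      using arcs_ends_symmetric[OF sym_arcs that] .
  qed (use assms(5) adj_not_same in auto)
  then obtain g where g: "sized_coloring ?E (verts G) {1..d} c g" ..
  moreover have "g u \<noteq> g w" if "u \<rightarrow>\<^bsub>G\<^esub> w" for u w
    using that adj_in_verts[OF that] g by (simp add: sized_coloring_def proper_on_def)
  ultimately have "prescribed_coloring G d c g"
    by (auto simp: sized_coloring_def proper_on_def prescribed_coloring_def proper_coloring_def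
      color_class_def)
  then show ?thesis by blast
qed

end
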